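(* The following identity of power series in $q$ holds: $$G_2(q)^2=G_2(q^2)+G_2(q)\left(48\,G_2(q^2)+4096\,G_2(q^2)^2\right).$$
   Context: $G_2(q)=q\prod_{n\ge1}\left(\frac{1-q^{2n}}{1-q^n}\right)^{24}$; equivalently, with $q=e^{2\pi i\tau}$, $\operatorname{Im}\tau>0$, and $\eta(\tau)=e^{\pi i\tau/12}\prod_{n\ge1}(1-e^{2\pi i n\tau})$ the Dedekind eta function, $G_2(q)=\left(\eta(2\tau)/\eta(\tau)\right)^{24}$. *)

theory Defs
  imports "HOL-Analysis.Analysis" "HOL-Computational_Algebra.Formal_Power_Series"
begin

(* The infinite product is taken in the X-adic topology of the formal power series;
   its index is shifted so that n = 0 gives the first factor, (1 - X^2) / (1 - X). *)
definition G2 :: "complex fps" where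
  "G2 = fps_X * (\<Prod>n. ((1 - fps_X ^ (2 * Suc n)) / (1 - fps_X ^ Suc n)) ^ 24)"

end

theory Submission
  imports Defs
begin

unbundle no vec_syntax
unbundle fps_syntax

text \<open>
  Let \<open>E(q) = \<Prod>n\<ge>1. 1 - q^n\<close> and put \<open>a = E(q)^8\<close>, \<open>b = E(q\<^sup>2)^8\<close>, \<open>c = E(q^4)^8\<close>. Then
  \<open>G2(q) = q b^3 / a^3\<close> and \<open>G2(q\<^sup>2) = q\<^sup>2 c^3 / b^3\<close> (\<open>G2_times_euler\<close>). Jacobi's identity
  \<open>\<theta>\<^sub>3^4 = \<theta>\<^sub>2^4 + \<theta>\<^sub>4^4\<close>, written with eta products, says \<open>b^3 = a c (a + 16 q c)\<close>
  (\<open>jacobi_aequatio_identica\<close>). Its cube is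
  \<open>b^9 = a^3 c^3 (a^3 + 48 q a c (a + 16 q c) + 4096 q^3 c^3) = a^3 c^3 (a^3 + 48 q b^3 + 4096 q^3 c^3)\<close>,
  and multiplication by \<open>q\<^sup>2 / (a^6 b^3)\<close> turns this into the modular equation.

  Jacobi's identity is proved with formal power series only. The one additive input is that
  \<open>\<theta>(q) = \<Sum>a\<in>\<int>. q^(a^2)\<close> is a product. This is Gauss's identity; Shanks' finite version of it has a
  telescoping proof (\<open>shanks_square_sum\<close>), and its error term vanishes in the limit
  (\<open>theta_compose_neg_X_times_euler\<close>). A bijection between representations of \<open>n\<close> and of \<open>2 n\<close> by two
  squares gives \<open>\<theta>(q)\<^sup>2 + \<theta>(-q)\<^sup>2 = 2 \<theta>(q\<^sup>2)\<^sup>2\<close> (\<open>theta_dissection\<close>), while \<open>\<theta>(q) \<theta>(-q) = \<theta>(-q\<^sup>2)\<^sup>2\<close> is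
  visible from the products. Hence \<open>D(q) = \<theta>(q)^4 - \<theta>(-q)^4\<close> satisfies
  \<open>D(q)\<^sup>2 = 16 \<theta>(q\<^sup>2)^4 D(q\<^sup>2)\<close>. The eta product \<open>16 q E(q^4)^8 / E(q\<^sup>2)^4\<close> for \<open>\<theta>\<^sub>2^4\<close> satisfies the same
  equation, and the quotient \<open>R\<close> of the two has constant term \<open>1\<close> and \<open>R(q)\<^sup>2 = R(q\<^sup>2)\<close>, which forces
  \<open>R = 1\<close> (\<open>square_eq_compose_square_imp_1\<close>).
\<close>

section \<open>Limits and composition of formal power series\<close>

lemma tendsto_add_fps:
  fixes f g :: "'b \<Rightarrow> 'a::group_add fps"
  assumes "(f \<longlongrightarrow> a) F" "(g \<longlongrightarrow> b) F"
  shows "((\<lambda>x. f x + g x) \<longlongrightarrow> a + b) F"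
proof (rule tendsto_fpsI)
  fix n
  have "eventually (\<lambda>x. f x $ n = a $ n) F" "eventually (\<lambda>x. g x $ n = b $ n) F"
    using assms by (simp_all add: tendsto_fps_iff)
  then show "eventually (\<lambda>x. (f x + g x) $ n = (a + b) $ n) F"
    by eventually_elim simp
qed

lemma tendsto_mult_fps:
  fixes f g :: "'b \<Rightarrow> 'a::ring fps"
  assumes "(f \<longlongrightarrow> a) F" "(g \<longlongrightarrow> b) F"
  shows "((\<lambda>x. f x * g x) \<longlongrightarrow> a * b) F"
proof (rule tendsto_fpsI)
  fix n
  have "eventually (\<lambda>x. \<forall>k\<in>{..n}. f x $ k = a $ k) F" "eventually (\<lambda>x. \<forall>k\<in>{..n}. g x $ k = b $ k) F"
    using assms by (simp_all add: tendsto_fps_iff eventually_ball_finite)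
  then show "eventually (\<lambda>x. (f x * g x) $ n = (a * b) $ n) F"
    by eventually_elim (simp add: fps_mult_nth)
qed

lemma tendsto_power_fps:
  fixes f :: "'b \<Rightarrow> 'a::ring_1 fps"
  assumes "(f \<longlongrightarrow> a) F"
  shows "((\<lambda>x. f x ^ n) \<longlongrightarrow> a ^ n) F"
  by (induction n) (auto intro!: tendsto_mult_fps assms)

lemma tendsto_compose_fps:
  fixes f :: "'b \<Rightarrow> 'a::ring_1 fps"
  assumes "(f \<longlongrightarrow> a) F"
  shows "((\<lambda>x. f x oo c) \<longlongrightarrow> (a oo c)) F"
proof (rule tendsto_fpsI)
  fix n
  have "eventually (\<lambda>x. \<forall>k\<in>{..n}. f x $ k = a $ k) F"
    using assms by (simp_all add: tendsto_fps_iff eventually_ball_finite)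
  then show "eventually (\<lambda>x. (f x oo c) $ n = (a oo c) $ n) F"
    by eventually_elim (simp add: fps_compose_nth)
qed

lemma fps_nth_compose_X_square:
  fixes f :: "'a::comm_ring_1 fps"
  shows "(f oo fps_X ^ 2) $ n = (if even n then f $ (n div 2) else 0)"
proof -
  have "(f oo fps_X ^ 2) $ n = (\<Sum>i=0..n. if n = 2 * i then f $ i else 0)"
    by (simp add: fps_compose_nth if_distrib flip: power_mult cong: if_cong)
  also have "\<dots> = (\<Sum>i=0..n. if i = n div 2 then (if even n then f $ i else 0) else 0)"
    by (intro sum.cong) auto
  also have "\<dots> = (if even n then f $ (n div 2) else 0)"
    by simp
  finally show ?thesis .
qed

lemma compose_X_square_twice:
  fixes f :: "'a::idom fps"
  shows "f oo fps_X ^ 2 oo fps_X ^ 2 = f oo fps_X ^ 4"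
  by (subst fps_compose_assoc[symmetric]; simp flip: fps_compose_power power_mult)

lemma fps_power_nth_1:
  fixes f :: "'a::comm_ring_1 fps"
  shows "(f ^ n) $ 1 = of_nat n * (f $ 0) ^ (n - 1) * f $ 1"
proof (induction n)
  case (Suc n)
  have "(f ^ Suc n) $ 1 = f $ 0 * (f ^ n) $ 1 + f $ 1 * (f ^ n) $ 0"
    by (simp add: fps_mult_nth)
  thus ?case
    unfolding Suc.IH fps_nth_power_0 by (cases n) (simp_all add: algebra_simps)
qed simp

section \<open>The Euler product\<close>

text \<open>
  The finite \<open>q\<close>-Pochhammer symbol \<open>(q; q)\<^sub>n\<close>. The base is an arbitrary ring element, so that the
  partial products of \<open>E(X)\<close>, \<open>E(-X)\<close>, \<open>E(X^2)\<close> and \<open>E(X^4)\<close> are all instances.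
\<close>

definition qpoch :: "'a::comm_ring_1 \<Rightarrow> nat \<Rightarrow> 'a" where
  "qpoch q n = (\<Prod>k<n. 1 - q ^ Suc k)"

lemma qpoch_0 [simp]: "qpoch q 0 = 1"
  by (simp add: qpoch_def)

lemma qpoch_Suc: "qpoch q (Suc n) = qpoch q n * (1 - q ^ Suc n)"
  by (simp add: qpoch_def)

definition euler :: "complex fps" where
  "euler = (\<Prod>n. 1 - fps_X ^ Suc n)"

lemma euler_has_prod: "(\<lambda>n. 1 - fps_X ^ Suc n :: complex fps) has_prod euler"
proof -
  let ?f = "\<lambda>n. 1 - fps_X ^ Suc n :: complex fps"
  have nth0: "?f n $ 0 = 1" for n
    by simp
  have nz: "?f n \<noteq> 0" for n
    using nth0[of n] by (metis fps_zero_nth zero_neq_one)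
  obtain P where P: "(\<lambda>n. \<Prod>k\<le>n. ?f k) \<longlonglongrightarrow> P"
    using tendsto_prod_fps[of ?f "\<lambda>n. n"] nz by (auto simp: fps_X_power_subdegree simp del: power_Suc)
  have prod0: "(\<Prod>k\<le>n. ?f k) $ 0 = 1" for n
    by (induction n) (simp_all del: power_Suc)
  have "P $ 0 = 1"
    using P prod0 by (auto simp: tendsto_fps_iff dest!: spec[of _ 0])
  hence "P \<noteq> 0" by auto
  hence "?f has_prod P"
    using P by (simp add: has_prod_def raw_has_prod_def)
  thus ?thesis
    unfolding euler_def using has_prod_unique by blast
qed

lemma qpoch_LIMSEQ_euler: "qpoch fps_X \<longlonglongrightarrow> euler"
proof -
  have "(\<lambda>n. \<Prod>k\<le>n. 1 - fps_X ^ Suc k) \<longlonglongrightarrow> euler"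
    using euler_has_prod by (auto simp: has_prod_def raw_has_prod_def)
  hence "(\<lambda>n. qpoch fps_X (Suc n)) \<longlonglongrightarrow> euler"
    by (simp add: qpoch_def lessThan_Suc_atMost)
  thus ?thesis by (simp only: filterlim_sequentially_Suc)
qed

lemma euler_nth_0: "euler $ 0 = 1"
proof -
  have "qpoch (fps_X :: complex fps) n $ 0 = 1" for n
    by (induction n) (simp_all add: qpoch_Suc)
  thus ?thesis
    using qpoch_LIMSEQ_euler by (auto simp: tendsto_fps_iff dest!: spec[of _ 0])
qed

lemma qpoch_LIMSEQ_compose:
  fixes c :: "complex fps"
  assumes "c $ 0 = 0"
  shows "qpoch c \<longlonglongrightarrow> (euler oo c)"
proof -
  have "(fps_X oo c) = c" using assms by simp
  hence "qpoch fps_X n oo c = qpoch c n" for n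
    using assms
    by (simp add: qpoch_def fps_compose_prod_distrib fps_compose_sub_distrib 
        fps_compose_power[symmetric] del: power_Suc)
  thus ?thesis
    using tendsto_compose_fps[OF qpoch_LIMSEQ_euler, of c] by simp
qed

text \<open>
  Split the factors \<open>1 - (-q)^m\<close> by the parity of \<open>m\<close>: for even \<open>m\<close> they already occur in \<open>E(q^2)\<close>,
  and for odd \<open>m\<close> they are \<open>1 + q^m\<close>, which \<open>1 - q^m\<close> turns into \<open>1 - q^(2m)\<close>. The factors
  \<open>1 - q^(2m)\<close> with odd \<open>m\<close> are those of \<open>E(q^2)\<close> that are missing from \<open>E(q^4)\<close>. With the
  truncations chosen below the count is exact at every finite stage.
\<close>

lemma euler_compose_neg_X:
  "(euler oo - fps_X) * euler * (euler oo fps_X ^ 4) = (euler oo fps_X ^ 2) ^ 3"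
proof -
  have finite: "qpoch (- q) (2 * n) * qpoch q (2 * n) * qpoch (q ^ 4) n =
      (qpoch (q\<^sup>2) n)\<^sup>2 * qpoch (q\<^sup>2) (2 * n)" for q :: "complex fps" and n
  proof (induction n)
    case (Suc n)
    define u v where "u = q ^ Suc (2 * n)" and "v = q ^ Suc (Suc (2 * n))"
    have m: "(- q) ^ Suc (2 * n) = - u" "(- q) ^ Suc (Suc (2 * n)) = v"
      by (simp_all only: u_def v_def power_minus_odd power_minus_even even_Suc_Suc_iff even_Suc
            even_mult_iff even_numeral HOL.simp_thms)
    have exponents: "q ^ (4 * Suc n) = q ^ (Suc (Suc (2 * n)) * 2)"
      "q ^ (2 * Suc n) = q ^ Suc (Suc (2 * n))" "q ^ (2 * Suc (2 * n)) = q ^ (Suc (2 * n) * 2)"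
      "q ^ (2 * Suc (Suc (2 * n))) = q ^ (Suc (Suc (2 * n)) * 2)"
      by (rule arg_cong[of _ _ "power q"], simp)+
    have m': "(q ^ 4) ^ Suc n = v\<^sup>2" "(q\<^sup>2) ^ Suc n = v" 
      "(q\<^sup>2) ^ Suc (2 * n) = u\<^sup>2" "(q\<^sup>2) ^ Suc (Suc (2 * n)) = v\<^sup>2"
      unfolding u_def v_def power_mult[symmetric] by (rule exponents)+
    have two: "2 * Suc n = Suc (Suc (2 * n))" by simp
    have "qpoch (- q) (2 * Suc n) * qpoch q (2 * Suc n) * qpoch (q ^ 4) (Suc n)
        = (qpoch (- q) (2 * n) * qpoch q (2 * n) * qpoch (q ^ 4) n) *
          ((1 + u) * (1 - v) * (1 - u) * (1 - v) * (1 - v\<^sup>2))"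
      unfolding two qpoch_Suc m m' u_def[symmetric] v_def[symmetric]
      by (simp only: mult_ac diff_minus_eq_add)
    also have "\<dots> = (qpoch (q\<^sup>2) (Suc n))\<^sup>2 * qpoch (q\<^sup>2) (2 * Suc n)"
      unfolding Suc.IH two qpoch_Suc m' by (simp add: power2_eq_square algebra_simps)
    finally show ?case .
  qed simp
  have dbl: "(\<lambda>n. qpoch c (2 * n)) \<longlonglongrightarrow> (euler oo c)" if "c $ 0 = 0" for c :: "complex fps"
    using LIMSEQ_subseq_LIMSEQ[OF qpoch_LIMSEQ_compose[OF that], of "\<lambda>n. 2 * n"]
    by (simp add: strict_mono_def o_def)
  have "(\<lambda>n. qpoch (- fps_X) (2 * n) * qpoch fps_X (2 * n) * qpoch (fps_X ^ 4) n)
      \<longlonglongrightarrow> (euler oo - fps_X) * (euler oo fps_X) * (euler oo fps_X ^ 4)"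
    by (intro tendsto_mult_fps dbl qpoch_LIMSEQ_compose) simp_all
  moreover have "(\<lambda>n. (qpoch (fps_X\<^sup>2) n)\<^sup>2 * qpoch (fps_X\<^sup>2) (2 * n))
      \<longlonglongrightarrow> (euler oo fps_X ^ 2)\<^sup>2 * (euler oo fps_X ^ 2)"
    by (intro tendsto_mult_fps tendsto_power_fps dbl qpoch_LIMSEQ_compose) simp_all
  ultimately have "(euler oo - fps_X) * (euler oo fps_X) * (euler oo fps_X ^ 4) = 
      (euler oo fps_X ^ 2)\<^sup>2 * (euler oo fps_X ^ 2)"
    unfolding finite by (rule LIMSEQ_unique)
  thus ?thesis by (simp add: power2_eq_square power3_eq_cube)
qed

text \<open>
  The infinite product in \<open>G2\<close> has the partial products \<open>((q^2; q^2)\<^sub>n / (q; q)\<^sub>n)^24\<close>, whose limit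
  is nonzero. Clearing the denominator leaves an identity without division, which composition
  with \<open>fps_X ^ 2\<close> respects.
\<close>

lemma G2_times_euler: "G2 * euler ^ 24 = fps_X * (euler oo fps_X ^ 2) ^ 24"
proof -
  let ?f = "\<lambda>n. ((1 - fps_X ^ (2 * Suc n)) / (1 - fps_X ^ Suc n)) ^ 24 :: complex fps"
  let ?Q = "((euler oo fps_X ^ 2) * inverse euler) ^ 24"
  have partial: "(\<Prod>k\<le>n. ?f k) = (qpoch (fps_X ^ 2) (Suc n) * inverse (qpoch fps_X (Suc n))) ^ 24" for n
  proof -
    have "?f k = ((1 - (fps_X ^ 2) ^ Suc k) * inverse (1 - fps_X ^ Suc k)) ^ 24" for k
      by (simp only: power_mult[symmetric]) (subst fps_divide_unit; simp)
    thus ?thesis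
      by (simp only: qpoch_def inverse_prod_fps prod.distrib[symmetric] prod_power_distrib lessThan_Suc_atMost)
  qed
  have "(\<lambda>n. \<Prod>k\<le>n. ?f k) \<longlonglongrightarrow> ?Q"
    unfolding partial
    by (intro tendsto_power_fps tendsto_mult_fps tendsto_inverse_fps LIMSEQ_Suc
          qpoch_LIMSEQ_compose qpoch_LIMSEQ_euler) (simp_all add: euler_nth_0)
  moreover have "?Q $ 0 = 1"
    by (simp add: fps_nth_power_0 euler_nth_0)
  hence "?Q \<noteq> 0" by force
  ultimately have "?f has_prod ?Q"
    by (simp add: has_prod_def raw_has_prod_def)
  hence "?Q = prodinf ?f"
    by (rule has_prod_unique)
  hence G2: "G2 = fps_X * ?Q"
    by (simp only: G2_def)
  have one: "inverse euler ^ 24 * euler ^ 24 = 1"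
    by (simp add: inverse_mult_eq_1 euler_nth_0 flip: power_mult_distrib)
  show ?thesis
    unfolding G2 power_mult_distrib mult.assoc one by simp
qed

section \<open>The theta series as a product\<close>

text \<open>
  Shanks' finite form of Gauss's identity \<open>(\<Sum>a\<in>\<int>. (-1)^a q^(a^2)) = (\<Prod>k\<ge>1. (1 - q^k) / (1 + q^k))\<close>,
  with the denominators cleared: the sum on the right is an error term, divisible by \<open>q ^ Suc n\<close>.
  In the induction on \<open>n\<close>, the \<open>j\<close>-th error term of stage \<open>n + 1\<close> differs from \<open>1 + q ^ Suc n\<close> times
  that of stage \<open>n\<close> by a difference \<open>g (Suc j) - g j\<close>, so the sum telescopes.
\<close>

lemma shanks_square_sum:
  fixes q :: "'a::comm_ring_1"
  defines "A \<equiv> \<lambda>m n. \<Prod>i\<in>{m..<n}. 1 - q ^ Suc i"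
  defines "B \<equiv> \<lambda>n. \<Prod>i<n. 1 + q ^ Suc i"
  shows "(1 + 2 * (\<Sum>j<n. (-1) ^ Suc j * q ^ (Suc j)\<^sup>2)) * B n =
         qpoch q n + 2 * (\<Sum>j<n. (-1) ^ Suc j * q ^ (Suc j * Suc n) * (B j * A (Suc j) n))"
proof (induction n)
  case 0
  show ?case by (simp add: B_def)
next
  case (Suc n)
  define S where "S = 1 + 2 * (\<Sum>j<n. (-1) ^ Suc j * q ^ (Suc j)\<^sup>2)"
  define W where "W = (\<lambda>n j. (-1) ^ Suc j * q ^ (Suc j * Suc n) * (B j * A (Suc j) n))"
  define t where "t = (-1) ^ Suc n * q ^ (Suc n)\<^sup>2"
  define g where "g = (\<lambda>j. (-1) ^ Suc j * q ^ (Suc j * Suc n) * (B j * A j n))"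
  have A_Suc: "A m (Suc n) = A m n * (1 - q ^ Suc n)" if "m \<le> n" for m
    using that by (simp add: A_def)
  have A_first: "A j n = (1 - q ^ Suc j) * A (Suc j) n" if "j < n" for j
    using that by (simp add: A_def prod.atLeast_Suc_lessThan)
  have B_Suc: "B (Suc j) = B j * (1 + q ^ Suc j)" for j
    by (simp add: B_def)
  have A_empty: "A m m = 1" for m
    by (simp add: A_def)
  have A_full: "A 0 n = qpoch q n"
    by (simp add: A_def qpoch_def atLeast0LessThan)
  have step: "W (Suc n) j = (1 + q ^ Suc n) * W n j + (g (Suc j) - g j)" if "j < n" for j
  proof -
    have e1: "q ^ (Suc j * Suc (Suc n)) = q ^ (Suc j * Suc n) * q ^ Suc j"
      by (simp flip: power_add add: algebra_simps)
    have e2: "q ^ (Suc (Suc j) * Suc n) = q ^ (Suc j * Suc n) * q ^ Suc n"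
      by (simp flip: power_add add: algebra_simps)
    have e3: "(- 1 :: 'a) ^ Suc (Suc j) = - ((- 1) ^ Suc j)"
      by simp
    (* u (1 - v) - (1 + v) = - v (1 + u) - (1 - u): on the right, 1 + u extends the product B
       upwards, giving g (Suc j), and 1 - u extends A downwards, giving g j. *)
    have ring: "s * (p * u) * (b * (a * (1 - v))) =
        (1 + v) * (s * p * (b * a)) +
        (- s * (p * v) * (b * (1 + u) * a) - s * p * (b * ((1 - u) * a)))"
      for s p u b a v :: 'a
      by (simp add: algebra_simps)
    show ?thesis
      unfolding W_def g_def e1 e2 e3 B_Suc A_first[OF that] A_Suc[OF Suc_leI[OF that]]
      by (rule ring)
  qed
  have "(\<Sum>j<Suc n. W (Suc n) j) = (1 + q ^ Suc n) * (\<Sum>j<n. W n j) + (g n - g 0) + W (Suc n) n"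
    by (simp add: step sum.distrib sum_distrib_left sum_lessThan_telescope)
  moreover have "W (Suc n) n = q ^ Suc n * g n"
  proof -
    have "q ^ (Suc n * Suc (Suc n)) = q ^ Suc n * q ^ (Suc n * Suc n)"
      by (simp flip: power_add add: algebra_simps)
    thus ?thesis
      by (simp only: W_def g_def A_empty) (simp only: ac_simps)
  qed
  moreover have "g 0 = - (q ^ Suc n * qpoch q n)"
    by (simp add: g_def B_def A_full)
  moreover have "g n = (-1) ^ Suc n * q ^ (Suc n)\<^sup>2 * B n"
    by (simp only: g_def A_empty power2_eq_square mult_1_right)
  moreover have "S * B n = qpoch q n + 2 * (\<Sum>j<n. W n j)"
    using Suc.IH by (simp only: S_def W_def)
  ultimately have sums: "(\<Sum>j<Suc n. W (Suc n) j) =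
        (1 + q ^ Suc n) * (\<Sum>j<n. W n j) + (t * B n + q ^ Suc n * qpoch q n) + q ^ Suc n * (t * B n)"
      and IH: "S * B n = qpoch q n + 2 * (\<Sum>j<n. W n j)"
    by (simp_all only: t_def minus_minus diff_minus_eq_add)
  have "(S + 2 * t) * (B n * (1 + q ^ Suc n)) = (1 + q ^ Suc n) * (S * B n + 2 * (t * B n))"
    by (simp only: algebra_simps)
  also have "\<dots> = qpoch q n * (1 - q ^ Suc n) + 2 * (\<Sum>j<Suc n. W (Suc n) j)"
    unfolding IH sums by (simp add: algebra_simps del: power_Suc)
  finally have "qpoch q (Suc n) + 2 * (\<Sum>j<Suc n. W (Suc n) j)
       = (S + 2 * t) * B (Suc n)"
    unfolding qpoch_Suc B_Suc by (rule sym)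
  thus ?case
    by (simp only: S_def W_def t_def sum.lessThan_Suc distrib_left add.assoc)
qed

text \<open>
  The theta series \<open>\<Sum>a\<in>\<int>. q^(a^2)\<close>, given by its coefficients as numbers of representations so that
  the coefficients of its square count lattice points on circles.
\<close>

definition theta :: "complex fps" where
  "theta = Abs_fps (\<lambda>n. of_nat (card {a::int. a\<^sup>2 = int n}))"

lemma theta_nth: "theta $ n = of_nat (card {a::int. a\<^sup>2 = int n})"
  by (simp add: theta_def)

lemma theta_partial_sums: "(\<lambda>n. 1 + 2 * (\<Sum>j<n. fps_X ^ (Suc j)\<^sup>2)) \<longlonglongrightarrow> theta"
proof (rule tendsto_fpsI)
  fix k :: nat
  show "\<forall>\<^sub>F n in sequentially. (1 + 2 * (\<Sum>j<n. fps_X ^ (Suc j)\<^sup>2)) $ k = theta $ k"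
    using eventually_ge_at_top[of k]
  proof eventually_elim
    case (elim n)
    have coeff: "(1 + 2 * (\<Sum>j<n. fps_X ^ (Suc j)\<^sup>2) :: complex fps) $ k
        = (if k = 0 then 1 else 0) + 2 * (\<Sum>j<n. if k = (Suc j)\<^sup>2 then 1 else 0)"
    proof -
      have "(\<Sum>j<n. fps_X ^ (Suc j)\<^sup>2 :: complex fps) $ k = (\<Sum>j<n. if k = (Suc j)\<^sup>2 then 1 else 0)"
        by (simp only: fps_sum_nth fps_X_power_nth)
      thus ?thesis
        by (simp only: fps_add_nth fps_one_nth mult_2)
    qed
    consider "k = 0" | m where "k = (Suc m)\<^sup>2" | "\<And>m. k \<noteq> m\<^sup>2"
      by (metis not0_implies_Suc zero_power2)
    thus ?case
    proof cases
      case 1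
      thus ?thesis unfolding coeff by (simp add: theta_def)
    next
      case (2 m)
      have "m < n"
        using elim 2 by (simp add: power2_eq_square)
      have iff: "k = (Suc j)\<^sup>2 \<longleftrightarrow> j = m" for j
        unfolding 2 by (metis Suc_inject power2_eq_imp_eq zero_le)
      have "(\<Sum>j<n. if k = (Suc j)\<^sup>2 then 1 else 0 :: complex) = 1"
        unfolding iff using \<open>m < n\<close> by simp
      moreover have "{a::int. a\<^sup>2 = int k} = {int (Suc m), - int (Suc m)}"
        unfolding 2 by (simp only: of_nat_power power2_eq_iff) blast
      ultimately show ?thesis
        unfolding coeff using 2 by (simp add: theta_def)
    next
      case 3
      have "{a::int. a\<^sup>2 = int k} = {}"
      proof -
        have False if "a\<^sup>2 = int k" for a :: int
          using 3[of "nat \<bar>a\<bar>"] that by (simp add: nat_power_eq [symmetric])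
        thus ?thesis by auto
      qed
      moreover have "(\<Sum>j<n. if k = (Suc j)\<^sup>2 then 1 else 0 :: complex) = 0"
        by (intro sum.neutral ballI if_not_P 3)
      ultimately show ?thesis
        unfolding coeff using 3[of 0] by (simp add: theta_def)
    qed
  qed
qed

text \<open>
  Gauss's product for theta. In \<open>shanks_square_sum\<close> at \<open>q = -X\<close> the signs cancel, because \<open>a\<close> and
  \<open>a^2\<close> have the same parity, and the error term tends to zero. The product of the \<open>1 + q^k\<close>
  is removed with the help of \<open>(1 + q^k) (1 - q^k) = 1 - q^(2k)\<close>.
\<close>

lemma theta_compose_neg_X_times_euler:
  "theta * (euler oo fps_X ^ 2) = (euler oo - fps_X) ^ 2"
proof -
  define B :: "nat \<Rightarrow> complex fps" where "B = (\<lambda>n. \<Prod>i<n. 1 + (- fps_X) ^ Suc i)"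
  define S :: "nat \<Rightarrow> complex fps" where "S = (\<lambda>n. 1 + 2 * (\<Sum>j<n. fps_X ^ (Suc j)\<^sup>2))"
  define R :: "nat \<Rightarrow> complex fps" where
    "R = (\<lambda>n. \<Sum>j<n. (-1) ^ Suc j * (- fps_X) ^ (Suc j * Suc n) *
                 (B j * (\<Prod>i\<in>{Suc j..<n}. 1 - (- fps_X) ^ Suc i)))"
  have sign: "(-1) ^ Suc j * (- fps_X) ^ (Suc j)\<^sup>2 = (fps_X ^ (Suc j)\<^sup>2 :: complex fps)" for j
  proof -
    have "(- fps_X) ^ (Suc j)\<^sup>2 = (-1) ^ (Suc j)\<^sup>2 * (fps_X ^ (Suc j)\<^sup>2 :: complex fps)"
      by (rule power_minus)
    moreover have "(-1) ^ (Suc j)\<^sup>2 = ((-1) ^ Suc j :: complex fps)"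
      by (simp add: minus_one_power_iff del: power_Suc)
    moreover have "(-1) ^ Suc j * ((-1) ^ Suc j * x) = (x :: complex fps)" for x
      by (simp add: minus_one_power_iff)
    ultimately show ?thesis by (simp only: mult.assoc)
  qed
  have SB: "S n * B n = qpoch (- fps_X) n + 2 * R n" for n
    using shanks_square_sum[of "- fps_X :: complex fps" n] unfolding sign B_def S_def R_def .
  have Bq: "B n * qpoch (- fps_X) n = qpoch (fps_X ^ 2) n" for n
  proof -
    have "(1 + (- fps_X) ^ Suc i) * (1 - (- fps_X) ^ Suc i) = (1 - (fps_X\<^sup>2) ^ Suc i :: complex fps)"
      for i :: nat
    proof -
      have "(1 + y) * (1 - y) = 1 - y\<^sup>2" for y :: "complex fps"
        by (simp add: power2_eq_square algebra_simps)
      moreover have "((- fps_X) ^ Suc i)\<^sup>2 = ((fps_X\<^sup>2) ^ Suc i :: complex fps)"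
        by (metis power2_minus power_mult mult.commute)
      ultimately show ?thesis by metis
    qed
    thus ?thesis unfolding B_def qpoch_def prod.distrib[symmetric] by (intro prod.cong refl)
  qed
  have "R \<longlonglongrightarrow> 0"
  proof (rule tendsto_fpsI)
    fix k
    show "\<forall>\<^sub>F n in sequentially. R n $ k = 0 $ k"
      using eventually_ge_at_top[of k]
    proof eventually_elim
      case (elim n)
      have "fps_X ^ Suc n dvd R n"
        unfolding R_def
      proof (rule dvd_sum)
        fix j
        have "(- fps_X) ^ (Suc j * Suc n) = (-1) ^ (Suc j * Suc n) * (fps_X ^ Suc n * fps_X ^ (j * Suc n) :: complex fps)"
          by (subst power_minus) (simp only: mult_Suc power_add)
        hence "fps_X ^ Suc n dvd ((- fps_X) ^ (Suc j * Suc n) :: complex fps)"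
          by (metis dvd_triv_left dvd_mult)
        thus "fps_X ^ Suc n dvd (-1) ^ Suc j * (- fps_X) ^ (Suc j * Suc n) *
            (B j * (\<Prod>i\<in>{Suc j..<n}. 1 - (- fps_X) ^ Suc i))"
          by (rule dvd_mult2[OF dvd_mult])
      qed
      then obtain c where "R n = fps_X ^ Suc n * c" ..
      thus ?case using elim by (simp add: fps_X_power_mult_nth del: power_Suc)
    qed
  qed
  have "(\<lambda>n. S n * qpoch (fps_X ^ 2) n) \<longlonglongrightarrow> theta * (euler oo fps_X ^ 2)"
    unfolding S_def by (intro tendsto_mult_fps theta_partial_sums qpoch_LIMSEQ_compose) simp
  moreover have "S n * qpoch (fps_X ^ 2) n = qpoch (- fps_X) n * (qpoch (- fps_X) n + 2 * R n)" for n
    unfolding SB[symmetric] Bq[symmetric] by (simp only: mult_ac)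
  moreover have "(\<lambda>n. qpoch (- fps_X) n * (qpoch (- fps_X) n + 2 * R n))
      \<longlonglongrightarrow> (euler oo - fps_X) * ((euler oo - fps_X) + 2 * 0)"
    by (intro tendsto_mult_fps tendsto_add_fps tendsto_const qpoch_LIMSEQ_compose \<open>R \<longlonglongrightarrow> 0\<close>) simp_all
  ultimately have "theta * (euler oo fps_X ^ 2) = (euler oo - fps_X) * ((euler oo - fps_X) + 2 * 0)"
    by (simp only: LIMSEQ_unique)
  thus ?thesis by (simp add: power2_eq_square)
qed

section \<open>Dissection of the square of the theta series\<close>

lemma theta_square_nth:
  "(theta\<^sup>2) $ n = of_nat (card {(a::int, b::int). a\<^sup>2 + b\<^sup>2 = int n})"
proof -
  define Q where "Q = (\<lambda>m. {a::int. a\<^sup>2 = int m})"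
  have fin: "finite (Q m)" for m
  proof (rule finite_subset)
    show "Q m \<subseteq> {- int m..int m}"
    proof
      fix a assume "a \<in> Q m"
      hence "\<bar>a\<bar> * \<bar>a\<bar> = int m" by (simp add: Q_def power2_eq_square)
      moreover have "\<bar>a\<bar> * 1 \<le> \<bar>a\<bar> * \<bar>a\<bar>" by (cases "a = 0") (auto simp del: abs_mult_self_eq)
      ultimately show "a \<in> {- int m..int m}" by auto
    qed
  qed simp
  have split: "{(a::int, b::int). a\<^sup>2 + b\<^sup>2 = int n} = (\<Union>i\<in>{0..n}. Q i \<times> Q (n - i))"
  proof (intro equalityI subsetI)
    fix p assume "p \<in> {(a::int, b::int). a\<^sup>2 + b\<^sup>2 = int n}"
    then obtain a b where p: "p = (a, b)" "a\<^sup>2 + b\<^sup>2 = int n" by auto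
    hence "nat (a\<^sup>2) \<le> n" "a\<^sup>2 = int (nat (a\<^sup>2))" "b\<^sup>2 = int (n - nat (a\<^sup>2))"
      using zero_le_power2[of a] zero_le_power2[of b] by linarith+
    thus "p \<in> (\<Union>i\<in>{0..n}. Q i \<times> Q (n - i))"
      unfolding p Q_def by (intro UN_I[of "nat (a\<^sup>2)"]) simp_all
  qed (auto simp: Q_def of_nat_diff)
  have "card {(a::int, b::int). a\<^sup>2 + b\<^sup>2 = int n} = (\<Sum>i=0..n. card (Q i \<times> Q (n - i)))"
    unfolding split by (intro card_UN_disjoint) (auto simp: fin, auto simp: Q_def)
  thus ?thesis
    by (simp add: power2_eq_square[of theta] fps_mult_nth theta_nth Q_def card_cartesian_product)
qed

text \<open>
  Multiplication of \<open>a + b i\<close> by \<open>1 - i\<close>, up to conjugation, is the bijection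
  \<open>(a, b) \<mapsto> (a + b, a - b)\<close>; it is onto since \<open>c\<^sup>2 + d\<^sup>2\<close> even forces \<open>c\<close> and \<open>d\<close> to have equal parity.
\<close>

lemma sum_two_squares_double:
  "card {(a::int, b::int). a\<^sup>2 + b\<^sup>2 = 2 * n} = card {(a::int, b::int). a\<^sup>2 + b\<^sup>2 = n}"
proof -
  have "bij_betw (\<lambda>(a, b). (a + b, a - b)) {(a::int, b). a\<^sup>2 + b\<^sup>2 = n} {(a::int, b). a\<^sup>2 + b\<^sup>2 = 2 * n}"
  proof (rule bij_betwI[where g = "\<lambda>(c, d). ((c + d) div 2, (c - d) div 2)"])
    show "(\<lambda>(c, d). ((c + d) div 2, (c - d) div 2)) \<in>
        {(a::int, b). a\<^sup>2 + b\<^sup>2 = 2 * n} \<rightarrow> {(a::int, b). a\<^sup>2 + b\<^sup>2 = n}"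
    proof safe
      fix c d :: int assume eq: "c\<^sup>2 + d\<^sup>2 = 2 * n"
      hence "even (c\<^sup>2 + d\<^sup>2)" by simp
      hence "even (c + d)" "even (c - d)" by simp_all
      then obtain x y where xy: "c + d = 2 * x" "c - d = 2 * y" by (elim evenE)
      hence "c = x + y" "d = x - y" by linarith+
      hence "x\<^sup>2 + y\<^sup>2 = n"
        using eq unfolding \<open>c = x + y\<close> \<open>d = x - y\<close> by (simp add: power2_eq_square algebra_simps)
      thus "((c + d) div 2)\<^sup>2 + ((c - d) div 2)\<^sup>2 = n" by (simp add: xy)
    qed
    fix p assume "p \<in> {(a::int, b). a\<^sup>2 + b\<^sup>2 = 2 * n}"
    then obtain c d where p: "p = (c, d)" "c\<^sup>2 + d\<^sup>2 = 2 * n" by auto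
    hence "even (c\<^sup>2 + d\<^sup>2)" by simp
    hence "even (c + d)" "even (c - d)" by simp_all
    then obtain x y where xy: "c + d = 2 * x" "c - d = 2 * y" by (elim evenE)
    hence "c = x + y" "d = x - y" by linarith+
    thus "(\<lambda>(a, b). (a + b, a - b)) ((\<lambda>(c, d). ((c + d) div 2, (c - d) div 2)) p) = p"
      by (simp add: p)
  qed (auto simp: power2_eq_square algebra_simps)
  thus ?thesis by (rule bij_betw_same_card[symmetric])
qed

text \<open>
  The sum on the left keeps the even coefficients of \<open>theta\<^sup>2\<close>, doubled; by
  \<open>sum_two_squares_double\<close> the coefficient at \<open>2 * m\<close> is the one at \<open>m\<close>.
\<close>

lemma theta_dissection:
  "theta\<^sup>2 + (theta oo - fps_X)\<^sup>2 = 2 * (theta oo fps_X ^ 2)\<^sup>2"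
proof (rule fps_ext)
  fix n
  have double: "(theta\<^sup>2) $ (2 * m) = (theta\<^sup>2) $ m" for m
    using sum_two_squares_double[of "int m"] by (simp add: theta_square_nth)
  have "(theta oo c)\<^sup>2 = theta\<^sup>2 oo c" if "c $ 0 = 0" for c
    using that by (rule fps_compose_power)
  hence eqs: "(theta oo - fps_X)\<^sup>2 = theta\<^sup>2 oo - fps_X" "(theta oo fps_X ^ 2)\<^sup>2 = theta\<^sup>2 oo fps_X ^ 2"
    by simp_all
  show "(theta\<^sup>2 + (theta oo - fps_X)\<^sup>2) $ n = (2 * (theta oo fps_X ^ 2)\<^sup>2) $ n"
  proof (cases "even n")
    case True
    hence "(theta\<^sup>2) $ n = (theta\<^sup>2) $ (n div 2)"
      using double[of "n div 2"] by simp
    with True show ?thesis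
      unfolding eqs unfolding fps_compose_uminus' mult_2 by (simp add: fps_nth_compose_X_square)
  next
    case False
    thus ?thesis
      unfolding eqs unfolding fps_compose_uminus' mult_2 by (simp add: fps_nth_compose_X_square)
  qed
qed

section \<open>Jacobi's identity for fourth powers\<close>

text \<open>
  If \<open>f \<noteq> 1\<close>, then in \<open>(f - 1) * (f + 1) = (f - 1) oo fps_X ^ 2\<close> the left side has the same order of
  vanishing \<open>k > 0\<close> as \<open>f - 1\<close>, since \<open>f + 1\<close> has constant term \<open>2\<close>, whereas the right side vanishes to
  order \<open>2 * k\<close>.
\<close>

lemma square_eq_compose_square_imp_1:
  fixes f :: "'a::{idom, ring_char_0} fps"
  assumes "f\<^sup>2 = f oo fps_X ^ 2" "f $ 0 = 1"
  shows "f = 1"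
proof (rule ccontr)
  assume "f \<noteq> 1"
  define k where "k = subdegree (f - 1)"
  have nz: "(f - 1) $ k \<noteq> 0" 
    using \<open>f \<noteq> 1\<close> unfolding k_def by (intro nth_subdegree_nonzero) simp
  hence "k > 0"
    using assms(2) by (cases k) auto
  have "(f - 1) * (f + 1) = (f - 1) oo fps_X ^ 2"
    using assms(1) by (simp add: fps_compose_sub_distrib power2_eq_square algebra_simps)
  moreover have "((f - 1) oo fps_X ^ 2) $ k = 0"
  proof (cases "even k")
    case True
    hence "k div 2 < subdegree (f - 1)" using \<open>k > 0\<close> by (simp add: k_def)
    hence "(f - 1) $ (k div 2) = 0" by (rule nth_less_subdegree_zero)
    thus ?thesis by (simp only: fps_nth_compose_X_square if_True True)
  qed (simp add: fps_nth_compose_X_square)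
  moreover have "((f - 1) * (f + 1)) $ k = (f - 1) $ k * (f + 1) $ 0"
  proof -
    have "subdegree (f + 1) = 0"
      using assms(2) by (intro subdegree_eq_0) simp
    thus ?thesis
      using nth_subdegree_mult[of "f - 1" "f + 1"] by (simp add: k_def)
  qed
  ultimately show False
    using nz assms(2) by simp
qed

text \<open>
  The quotient \<open>f / g\<close> satisfies the hypothesis of \<open>square_eq_compose_square_imp_1\<close>. Hence a functional
  equation \<open>f(q)\<^sup>2 = K(q) f(q\<^sup>2)\<close> together with the constant term determines \<open>f\<close>.
\<close>

lemma square_over_compose_square_unique:
  fixes f g :: "'a::{field, ring_char_0} fps"
  assumes eq: "f\<^sup>2 * (g oo fps_X ^ 2) = g\<^sup>2 * (f oo fps_X ^ 2)"
    and const: "f $ 0 = g $ 0" "g $ 0 \<noteq> 0"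
  shows "f = g"
proof -
  define r where "r = f * inverse g"
  have f: "f = r * g"
    using const by (simp add: r_def mult.assoc inverse_mult_eq_1)
  have "g \<noteq> 0" and "g oo fps_X ^ 2 \<noteq> 0"
    using const(2) by (auto simp: fps_eq_iff intro: exI[of _ 0])
  moreover have "r\<^sup>2 * (g\<^sup>2 * (g oo fps_X ^ 2)) = (r oo fps_X ^ 2) * (g\<^sup>2 * (g oo fps_X ^ 2))"
    using eq by (simp add: f fps_compose_mult_distrib power_mult_distrib mult_ac)
  ultimately have "r\<^sup>2 = r oo fps_X ^ 2"
    by simp
  moreover have "r $ 0 = 1"
    using const by (simp add: r_def)
  ultimately have "r = 1"
    by (rule square_eq_compose_square_imp_1)
  thus ?thesis by (simp add: f)
qed

lemma theta_nth_0_1: "theta $ 0 = 1" "theta $ 1 = 2"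
proof -
  have "{a::int. a\<^sup>2 = 1} = {1, -1}"
    by (auto simp: power2_eq_1_iff)
  thus "theta $ 0 = 1" "theta $ 1 = 2"
    by (simp_all add: theta_nth)
qed

text \<open>
  Jacobi's \<open>\<theta>\<^sub>3^4 = \<theta>\<^sub>4^4 + \<theta>\<^sub>2^4\<close> with each theta function replaced by its product and the
  denominators cleared. Below, \<open>theta\<close> and \<open>p\<close> are \<open>\<theta>\<^sub>3\<close> and \<open>\<theta>\<^sub>4\<close> at \<open>q\<close>, and \<open>t\<close> and \<open>s\<close> are the same at
  \<open>q\<^sup>2\<close>; the product \<open>16 * fps_X * u\<close> is \<open>\<theta>\<^sub>2^4\<close>. The relations \<open>theta\<^sup>2 + p\<^sup>2 = 2 * t\<^sup>2\<close> and
  \<open>theta * p = s\<^sup>2\<close> (one step of the arithmetic-geometric mean) show that \<open>D = theta ^ 4 - p ^ 4\<close> satisfies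
  \<open>D(q)\<^sup>2 = 16 t^4 D(q\<^sup>2)\<close>. The product satisfies the same equation and has the same leading
  coefficient, so the two agree.
\<close>

lemma jacobi_aequatio_identica:
  fixes E1 E2 E4
  defines "E1 \<equiv> euler" and "E2 \<equiv> euler oo fps_X ^ 2" and "E4 \<equiv> euler oo fps_X ^ 4"
  shows "E2 ^ 24 = E1 ^ 16 * E4 ^ 8 + 16 * fps_X * E1 ^ 8 * E4 ^ 16"
proof -
  define E8 where "E8 = E4 oo fps_X ^ 2"
  define p where "p = theta oo - fps_X"
  define t where "t = theta oo fps_X ^ 2"
  define s where "s = p oo fps_X ^ 2"
  note [simp] = fps_compose_mult_distrib fps_compose_add_distrib fps_compose_sub_distrib
  have nth0: "E1 $ 0 = 1" "E2 $ 0 = 1" "E4 $ 0 = 1" "E8 $ 0 = 1"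
    by (simp_all add: E1_def E2_def E4_def E8_def euler_nth_0)
  hence nz: "E1 \<noteq> 0" "E2 \<noteq> 0" "E4 \<noteq> 0" "E8 \<noteq> 0"
    by force+
  have E4: "E2 oo fps_X ^ 2 = E4"
    by (simp only: E2_def E4_def compose_X_square_twice)
  have E2: "E1 oo fps_X ^ 2 = E2"
    by (simp only: E1_def E2_def)
  have E_neg: "(E1 oo - fps_X) * E1 * E4 = E2 ^ 3"
    using euler_compose_neg_X by (simp only: E1_def E2_def E4_def)
  have theta_E: "theta * E2 = (E1 oo - fps_X)\<^sup>2"
    using theta_compose_neg_X_times_euler by (simp only: E1_def E2_def)
  have theta: "theta * (E1\<^sup>2 * E4\<^sup>2) = E2 ^ 5"
  proof -
    have "E2 * (theta * (E1\<^sup>2 * E4\<^sup>2)) = ((E1 oo - fps_X) * E1 * E4)\<^sup>2"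
      using theta_E by (simp add: power_mult_distrib algebra_simps)
    also have "\<dots> = E2 * E2 ^ 5"
      unfolding E_neg by (simp flip: power_mult power_Suc)
    finally show ?thesis using nz by simp
  qed
  have p: "p * E2 = E1\<^sup>2"
  proof -
    have "(theta * E2) oo - fps_X = (E1 oo - fps_X)\<^sup>2 oo - fps_X"
      by (simp only: theta_E)
    moreover have "E2 oo - fps_X = E2"
      unfolding E2_def by (subst fps_compose_assoc[symmetric]; simp flip: fps_compose_power)
    moreover have "E1 oo - fps_X oo - fps_X = E1"
      by (subst fps_compose_assoc[symmetric]; simp add: fps_compose_uminus)
    ultimately show ?thesis
      by (simp add: p_def flip: fps_compose_power)
  qed
  have t: "t * (E2\<^sup>2 * E8\<^sup>2) = E4 ^ 5"
    using arg_cong[OF theta, of "\<lambda>f. f oo fps_X ^ 2"]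
    by (simp add: t_def E8_def E4 E2 flip: fps_compose_power)
  have s: "s * E4 = E2\<^sup>2"
    using arg_cong[OF p, of "\<lambda>f. f oo fps_X ^ 2"] 
    by (simp add: s_def E4 E2 flip: fps_compose_power)
  have add: "theta\<^sup>2 + p\<^sup>2 = 2 * t\<^sup>2"
    unfolding p_def t_def by (rule theta_dissection)
  have mult: "theta * p = s\<^sup>2"
  proof -
    have "(theta * p) * (E1\<^sup>2 * E4\<^sup>2 * E2) = (theta * (E1\<^sup>2 * E4\<^sup>2)) * (p * E2)"
      by (simp only: mult_ac)
    also have "\<dots> = (E2\<^sup>2)\<^sup>2 * (E1\<^sup>2 * E2)"
      unfolding theta p by (simp add: mult_ac flip: power_mult power_Suc)
    also have "\<dots> = s\<^sup>2 * (E1\<^sup>2 * E4\<^sup>2 * E2)"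
      unfolding s[symmetric] by (simp add: power_mult_distrib mult_ac)
    finally show ?thesis using nz by simp
  qed
  define D where "D = theta ^ 4 - p ^ 4"
  have D_compose: "D oo fps_X ^ 2 = t ^ 4 - s ^ 4"
    by (simp add: D_def t_def s_def fps_compose_power)
  have D_square: "D\<^sup>2 = 16 * t ^ 4 * (D oo fps_X ^ 2)"
  proof -
    have "D = (theta\<^sup>2 - p\<^sup>2) * (theta\<^sup>2 + p\<^sup>2)"
      by (simp add: D_def algebra_simps power4_eq_xxxx power2_eq_square)
    hence "D\<^sup>2 = (theta\<^sup>2 - p\<^sup>2)\<^sup>2 * (theta\<^sup>2 + p\<^sup>2)\<^sup>2"
      by (simp only: power_mult_distrib)
    also have "(theta\<^sup>2 - p\<^sup>2)\<^sup>2 = (theta\<^sup>2 + p\<^sup>2)\<^sup>2 - 4 * (theta * p)\<^sup>2"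
      by (simp add: algebra_simps power2_eq_square)
    also have "\<dots> * (theta\<^sup>2 + p\<^sup>2)\<^sup>2 = 16 * t ^ 4 * (t ^ 4 - s ^ 4)"
      unfolding add mult by (simp add: algebra_simps power4_eq_xxxx power2_eq_square)
    finally show ?thesis
      unfolding D_compose .
  qed
  (* D vanishes at the origin, where the uniqueness lemma needs a unit: divide by X. *)
  define d where "d = fps_shift 1 D"
  have p_nth: "p $ 0 = 1" "p $ 1 = -2"
    by (simp_all add: p_def fps_compose_uminus' theta_nth_0_1[unfolded One_nat_def])
  have D_nth: "D $ 0 = 0" "D $ 1 = 16"
    unfolding D_def fps_sub_nth fps_power_nth_1 fps_nth_power_0
    by (simp_all add: p_nth theta_nth_0_1 del: One_nat_def)
  have D: "D = fps_X * d"
  proof (rule fps_ext)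
    fix n show "D $ n = (fps_X * d) $ n"
      by (cases n) (simp_all add: d_def D_nth)
  qed
  define u where "u = E4 ^ 8 * inverse (E2 ^ 4)"
  have u: "u * E2 ^ 4 = E4 ^ 8"
    by (simp add: u_def mult.assoc inverse_mult_eq_1 nth0 fps_nth_power_0)
  have u_compose: "(u oo fps_X ^ 2) * E4 ^ 4 = E8 ^ 8"
    using arg_cong[OF u, of "\<lambda>f. f oo fps_X ^ 2"] by (simp add: E4 E8_def flip: fps_compose_power)
  have u_square: "u\<^sup>2 = t ^ 4 * (u oo fps_X ^ 2)"
  proof -
    have "u\<^sup>2 * (E2 ^ 8 * E8 ^ 8 * E4 ^ 4) = (u * E2 ^ 4)\<^sup>2 * E8 ^ 8 * E4 ^ 4"
      by (simp add: power_mult_distrib mult_ac flip: power_mult)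
    also have "\<dots> = (E4 ^ 5) ^ 4 * E8 ^ 8"
      unfolding u by (simp flip: power_mult power_add add: mult_ac)
    also have "\<dots> = (t * (E2\<^sup>2 * E8\<^sup>2)) ^ 4 * ((u oo fps_X ^ 2) * E4 ^ 4)"
      by (simp only: t u_compose)
    also have "\<dots> = t ^ 4 * (u oo fps_X ^ 2) * (E2 ^ 8 * E8 ^ 8 * E4 ^ 4)"
      by (simp add: power_mult_distrib mult_ac flip: power_mult)
    finally show ?thesis using nz by simp
  qed
  have d: "d = 16 * u"
  proof (rule square_over_compose_square_unique)
    have sixteen: "16 oo (fps_X ^ 2 :: complex fps) = 16"
      by (metis fps_const_compose numeral_fps_const)
    have "fps_X\<^sup>2 * d\<^sup>2 = fps_X\<^sup>2 * (16 * t ^ 4 * (d oo fps_X ^ 2))"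
      using D_square by (simp add: D power_mult_distrib mult_ac)
    hence "d\<^sup>2 = 16 * t ^ 4 * (d oo fps_X ^ 2)"
      by simp
    thus "d\<^sup>2 * (16 * u oo fps_X ^ 2) = (16 * u)\<^sup>2 * (d oo fps_X ^ 2)"
      by (simp add: sixteen power_mult_distrib u_square)
    show "d $ 0 = (16 * u) $ 0" "(16 * u) $ 0 \<noteq> 0"
      using D_nth(2) by (simp_all add: d_def u_def nth0 fps_nth_power_0)
  qed
  have "theta ^ 4 = p ^ 4 + 16 * fps_X * u"
    using D d by (simp add: D_def algebra_simps)
  hence "theta ^ 4 * (E1 ^ 8 * E4 ^ 8 * E2 ^ 4) = (p ^ 4 + 16 * fps_X * u) * (E1 ^ 8 * E4 ^ 8 * E2 ^ 4)"
    by (rule arg_cong)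
  also have "theta ^ 4 * (E1 ^ 8 * E4 ^ 8 * E2 ^ 4) = (theta * (E1\<^sup>2 * E4\<^sup>2)) ^ 4 * E2 ^ 4"
    by (simp add: power_mult_distrib mult_ac flip: power_mult)
  also have "\<dots> = E2 ^ 24"
    unfolding theta by (simp flip: power_mult power_add)
  also have "(p ^ 4 + 16 * fps_X * u) * (E1 ^ 8 * E4 ^ 8 * E2 ^ 4) =
      (p * E2) ^ 4 * (E1 ^ 8 * E4 ^ 8) + 16 * fps_X * (u * E2 ^ 4) * (E1 ^ 8 * E4 ^ 8)"
    by (simp add: power_mult_distrib algebra_simps)
  also have "\<dots> = E1 ^ 16 * E4 ^ 8 + 16 * fps_X * E1 ^ 8 * E4 ^ 16"
  proof -
    have powers: "E1 ^ 16 = (E1\<^sup>2) ^ 4 * E1 ^ 8" "E4 ^ 16 = E4 ^ 8 * E4 ^ 8"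
      by (simp_all flip: power_mult power_add)
    show ?thesis
      unfolding p u powers by (simp only: mult_ac)
  qed
  finally show ?thesis .
qed

section \<open>The modular equation\<close>

theorem lemma3p5:
  shows "G2 ^ 2 = fps_compose G2 (fps_X ^ 2)
           + G2 * (48 * fps_compose G2 (fps_X ^ 2) + 4096 * (fps_compose G2 (fps_X ^ 2)) ^ 2)"
proof -
  define H where "H = G2 oo fps_X ^ 2"
  define a b c where "a = euler ^ 8" and "b = (euler oo fps_X ^ 2) ^ 8"
    and "c = (euler oo fps_X ^ 4) ^ 8"
  have "a $ 0 = 1" "b $ 0 = 1"
    by (simp_all add: a_def b_def fps_nth_power_0 euler_nth_0)
  hence nz: "a \<noteq> 0" "b \<noteq> 0" by force+
  have G: "G2 * a ^ 3 = fps_X * b ^ 3"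
    using G2_times_euler by (simp add: a_def b_def flip: power_mult)
  have H: "H * b ^ 3 = fps_X\<^sup>2 * c ^ 3"
    using arg_cong[OF G2_times_euler, of "\<lambda>f. f oo fps_X ^ 2"]
    by (simp add: H_def b_def c_def fps_compose_mult_distrib compose_X_square_twice
          flip: power_mult fps_compose_power)
  have b: "b ^ 3 = a * c * (a + 16 * fps_X * c)"
    using jacobi_aequatio_identica by (simp add: a_def b_def c_def distrib_left mult_ac flip: power_mult power_add)
  have "G2\<^sup>2 * (a ^ 6 * b ^ 6) = (G2 * a ^ 3)\<^sup>2 * b ^ 6"
    by (simp add: power_mult_distrib mult_ac flip: power_mult)
  also have "\<dots> = fps_X\<^sup>2 * (b ^ 3) ^ 3 * b ^ 3"
    unfolding G by (simp add: power_mult_distrib mult_ac flip: power_mult power_add)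
  also have "\<dots> = fps_X\<^sup>2 * (a ^ 3 * c ^ 3 * (a ^ 3 + 48 * fps_X * b ^ 3 + 4096 * fps_X ^ 3 * c ^ 3)) * b ^ 3"
  proof -
    have "(a + 16 * fps_X * c) ^ 3 = a ^ 3 + 48 * fps_X * (a * c * (a + 16 * fps_X * c)) + 4096 * fps_X ^ 3 * c ^ 3"
      by (simp add: power3_eq_cube algebra_simps)
    thus ?thesis unfolding b by (simp add: power_mult_distrib)
  qed
  also have "\<dots> = (H * b ^ 3) * (a ^ 6 * b ^ 3) + (G2 * a ^ 3) * (48 * (H * b ^ 3) * (a ^ 3 * b ^ 3) + 4096 * (H * b ^ 3)\<^sup>2 * a ^ 3)"
    unfolding G H by (simp add: algebra_simps power_numeral_reduce)
  also have "\<dots> = (H + G2 * (48 * H + 4096 * H\<^sup>2)) * (a ^ 6 * b ^ 6)"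
    by (simp add: algebra_simps power_numeral_reduce)
  finally show ?thesis
    using nz unfolding H_def by simp
qed

end
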